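(* Let $\mathcal{H}$ be a Hilbert space and let $(H_0,D(H_0))$ and $(H,D(H))$ be closed, densely defined operators in $\mathcal{H}$, with $H_0$ self-adjoint. Let $\{e_n\}_{n\ge 0}$ be an orthonormal basis of $\mathcal{H}$ consisting of eigenvectors of $H_0$, let $T$ be a bounded operator on $\mathcal{H}$ with bounded inverse $T^{-1}$, and put $\varphi_n = Te_n$ and $\psi_n=(T^* )^{-1}e_n$ (so that $\{\varphi_n\}$ and $\{\psi_n\}$ are Riesz bases). Suppose that there are real numbers $\lambda_n$ such that for every $n$ one has $e_n\in D(H_0)$, $\varphi_n\in D(H)$, $\psi_n\in D(H^* )$ and $$H_0e_n=\lambda_ne_n,\qquad H\varphi_n=\lambda_n\varphi_n,\qquad H^*\psi_n=\lambda_n\psi_n .$$ Assume that for every $n$ $$TH_0e_n=HTe_n,\qquad H^*(T^* )^{-1}e_n=(T^* )^{-1}H_0e_n .$$ Then the following statements are equivalent: 1. $H\sim H_0$ with intertwining operator $T$. 2. The linear span of $\{Te_n\}$ is a core for $H$.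
   Context: Similarity: for two linear operators $(V,D(V))$ and $(K,D(K))$ in $\mathcal{H}$, one writes $V\sim K$ with intertwining operator $T$ if $T$ is a bounded operator on $\mathcal{H}$ with bounded inverse such that $TD(K)=D(V)$ and $VTf=TKf$ for every $f\in D(K)$. Core: if $S$ is a closed operator, a subspace $\mathcal{C}\subseteq D(S)$ is a core for $S$ if the closure of the restriction $S\upharpoonright\mathcal{C}$ equals $S$. *)

theory Defs
  imports "HOL-Analysis.Analysis"
begin

text \<open>Complex Hilbert spaces; the inner product is antilinear in its first argument.\<close>

class scaleC =
  fixes scaleC :: "complex \<Rightarrow> 'a \<Rightarrow> 'a"  (infixr \<open>*\<^sub>C\<close> 75)

class complex_vector = scaleC + real_vector +
  assumes scaleC_add_right: "a *\<^sub>C (x + y) = a *\<^sub>C x + a *\<^sub>C y"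
    and scaleC_add_left: "(a + b) *\<^sub>C x = a *\<^sub>C x + b *\<^sub>C x"
    and scaleC_scaleC: "a *\<^sub>C (b *\<^sub>C x) = (a * b) *\<^sub>C x"
    and scaleC_one: "1 *\<^sub>C x = x"
    and scaleR_scaleC: "r *\<^sub>R x = complex_of_real r *\<^sub>C x"

class complex_inner = complex_vector + real_normed_vector +
  fixes cinner :: "'a \<Rightarrow> 'a \<Rightarrow> complex"
  assumes cinner_commute: "cinner x y = cnj (cinner y x)"
    and cinner_add_right: "cinner x (y + z) = cinner x y + cinner x z"
    and cinner_scaleC_right: "cinner x (a *\<^sub>C y) = a * cinner x y"
    and cinner_ge_zero: "0 \<le> Re (cinner x x)"
    and cinner_eq_zero_iff: "cinner x x = 0 \<longleftrightarrow> x = 0"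
    and norm_eq_sqrt_cinner: "norm x = sqrt (Re (cinner x x))"

class chilbert_space = complex_inner + complete_space

global_interpretation complex_vector:
  vector_space "scaleC :: complex \<Rightarrow> 'a \<Rightarrow> 'a::complex_vector"
  defines csubspace = complex_vector.subspace
    and cspan = complex_vector.span
  by unfold_locales
    (simp_all add: scaleC_add_right scaleC_add_left scaleC_scaleC scaleC_one)

definition orthonormal_basis :: "(nat \<Rightarrow> 'a::complex_inner) \<Rightarrow> bool" where
  "orthonormal_basis e \<longleftrightarrow>
     (\<forall>m n. cinner (e m) (e n) = (if m = n then 1 else 0)) \<and>
     closure (cspan (range e)) = UNIV"

definition bounded_operator :: "('a::complex_inner \<Rightarrow> 'a) \<Rightarrow> bool" where
  "bounded_operator T \<longleftrightarrow>
     Vector_Spaces.linear scaleC scaleC T \<and> (\<exists>B. \<forall>x. norm (T x) \<le> B * norm x)"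

definition bounded_with_bounded_inverse :: "('a::complex_inner \<Rightarrow> 'a) \<Rightarrow> bool" where
  "bounded_with_bounded_inverse T \<longleftrightarrow>
     bounded_operator T \<and> bij T \<and> bounded_operator (inv T)"

definition bounded_adjoint :: "('a::complex_inner \<Rightarrow> 'a) \<Rightarrow> 'a \<Rightarrow> 'a" where
  "bounded_adjoint T = (THE S. \<forall>f g. cinner (T f) g = cinner f (S g))"

text \<open>
  An operator with a domain, \<open>(V, D(V))\<close>, is a partial function \<open>V\<close> with \<open>D(V) = dom V\<close>.
  Equality of operators, including equality of their domains, is then plain equality.
\<close>

type_synonym 'a pop = "'a \<Rightarrow> 'a option"

abbreviation papp :: "'a pop \<Rightarrow> 'a \<Rightarrow> 'a"  (infixr \<open>\<bullet>\<^sub>p\<close> 80) where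
  "V \<bullet>\<^sub>p f \<equiv> the (V f)"

definition linear_operator :: "'a::complex_vector pop \<Rightarrow> bool" where
  "linear_operator V \<longleftrightarrow> csubspace (dom V) \<and>
     (\<forall>f\<in>dom V. \<forall>g\<in>dom V. V \<bullet>\<^sub>p (f + g) = V \<bullet>\<^sub>p f + V \<bullet>\<^sub>p g) \<and>
     (\<forall>a. \<forall>f\<in>dom V. V \<bullet>\<^sub>p (a *\<^sub>C f) = a *\<^sub>C (V \<bullet>\<^sub>p f))"

definition closed_operator :: "'a::complex_inner pop \<Rightarrow> bool" where
  "closed_operator V \<longleftrightarrow> linear_operator V \<and> closed (Map.graph V)"

definition densely_defined :: "'a::complex_inner pop \<Rightarrow> bool" where
  "densely_defined V \<longleftrightarrow> closure (dom V) = UNIV"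

text \<open>
  The operator whose graph is the closure of the graph of \<open>V\<close>. It is meaningful only for
  closable \<open>V\<close>, where the value \<open>h\<close> is unique; every restriction of a closed operator is closable.
\<close>

definition operator_closure :: "'a::complex_inner pop \<Rightarrow> 'a pop" where
  "operator_closure V = (\<lambda>f. if \<exists>h. (f, h) \<in> closure (Map.graph V)
     then Some (THE h. (f, h) \<in> closure (Map.graph V)) else None)"

text \<open>Meaningful only for densely defined \<open>V\<close>, where the value \<open>h\<close> is unique.\<close>

definition operator_adjoint :: "'a::complex_inner pop \<Rightarrow> 'a pop" where
  "operator_adjoint V = (\<lambda>g. if \<exists>h. \<forall>f\<in>dom V. cinner (V \<bullet>\<^sub>p f) g = cinner f h
     then Some (THE h. \<forall>f\<in>dom V. cinner (V \<bullet>\<^sub>p f) g = cinner f h) else None)"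

definition self_adjoint :: "'a::complex_inner pop \<Rightarrow> bool" where
  "self_adjoint V \<longleftrightarrow> linear_operator V \<and> densely_defined V \<and> operator_adjoint V = V"

definition is_core :: "'a::complex_inner set \<Rightarrow> 'a pop \<Rightarrow> bool" where
  "is_core C S \<longleftrightarrow> csubspace C \<and> C \<subseteq> dom S \<and> operator_closure (S |` C) = S"

definition similar_via ::
    "'a::complex_inner pop \<Rightarrow> 'a pop \<Rightarrow> ('a \<Rightarrow> 'a) \<Rightarrow> bool" where
  "similar_via V K T \<longleftrightarrow> bounded_with_bounded_inverse T \<and>
     T ` dom K = dom V \<and> (\<forall>f\<in>dom K. V \<bullet>\<^sub>p T f = T (K \<bullet>\<^sub>p f))"

end

theory Submission
  imports Defs
begin

text \<open>
  The span of the \<open>e\<^sub>n\<close> is always a core for \<open>H\<^sub>0\<close>: the truncations \<open>P\<^sub>M f\<close> of the Fourier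
  expansion of \<open>f \<in> D(H\<^sub>0)\<close> converge to \<open>f\<close>, and \<open>H\<^sub>0 P\<^sub>M f = P\<^sub>M H\<^sub>0 f\<close> converges to \<open>H\<^sub>0 f\<close>,
  because \<open>H\<^sub>0\<close> is symmetric and \<open>e\<^sub>n\<close> are eigenvectors. The homeomorphism \<open>T \<times> T\<close> carries the
  graph of \<open>H\<^sub>0\<close> restricted to this span onto the graph of \<open>H\<close> restricted to the span of the
  \<open>T e\<^sub>n\<close>, hence it carries the graph of \<open>H\<^sub>0\<close> onto the closure of the latter graph. Similarity
  says that this image is the graph of \<open>H\<close>, and the core property says that this closure is.
\<close>

section \<open>Inner product identities and convergence of Fourier expansions\<close>

lemma cinner_add_left: "cinner (x + y) z = cinner x z + cinner y (z :: 'a::complex_inner)"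
  by (metis cinner_commute cinner_add_right complex_cnj_add)

lemma cinner_scaleC_left: "cinner (a *\<^sub>C x) y = cnj a * cinner x (y :: 'a::complex_inner)"
  by (metis cinner_commute cinner_scaleC_right complex_cnj_mult)

lemma cinner_zero_right [simp]: "cinner x (0 :: 'a::complex_inner) = 0"
  using cinner_add_right[of x 0 0] by simp

lemma cinner_diff_right: "cinner x (y - z) = cinner x y - cinner x (z :: 'a::complex_inner)"
  using cinner_add_right[of x "y - z" z] by simp

lemma cinner_sum_right: "cinner x (sum f A) = (\<Sum>i\<in>A. cinner x (f i :: 'a::complex_inner))"
  by (induction A rule: infinite_finite_induct) (auto simp: cinner_add_right)

lemma norm_add_orthogonal:
  fixes x y :: "'a::complex_inner"
  assumes "cinner x y = 0"
  shows "(norm (x + y))\<^sup>2 = (norm x)\<^sup>2 + (norm y)\<^sup>2"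
proof -
  have "cinner y x = 0"
    using assms cinner_commute[of y x] by simp
  then show ?thesis
    using assms cinner_ge_zero[of x] cinner_ge_zero[of y] cinner_ge_zero[of "x + y"]
    by (simp add: norm_eq_sqrt_cinner cinner_add_left cinner_add_right)
qed

text \<open>For orthonormal \<open>e\<close> this is the orthogonal projection onto the span of the
  first \<open>M\<close> vectors.\<close>

definition fourier_truncation :: "(nat \<Rightarrow> 'a::complex_inner) \<Rightarrow> nat \<Rightarrow> 'a \<Rightarrow> 'a" where
  "fourier_truncation e M x = (\<Sum>n<M. cinner (e n) x *\<^sub>C e n)"

lemma fourier_truncation_add:
  "fourier_truncation e M (x + y) = fourier_truncation e M x + fourier_truncation e M y"
  by (simp add: fourier_truncation_def cinner_add_right scaleC_add_left sum.distrib)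

lemma fourier_truncation_diff:
  "fourier_truncation e M (x - y) = fourier_truncation e M x - fourier_truncation e M y"
  using fourier_truncation_add[of e M "x - y" y] by simp

lemma fourier_truncation_scaleC:
  "fourier_truncation e M (a *\<^sub>C x) = a *\<^sub>C fourier_truncation e M x"
  by (simp add: fourier_truncation_def cinner_scaleC_right complex_vector.scale_sum_right)

text \<open>Bessel's inequality: the remainder \<open>x - ?P\<close> is orthogonal to each
  \<open>e k\<close> with \<open>k < M\<close>, hence to \<open>?P\<close>, and Pythagoras applies.
  It makes the truncations contractions, uniformly in \<open>M\<close>.\<close>

lemma norm_fourier_truncation_le:
  assumes on: "\<And>m n. cinner (e m) (e n) = (if m = n then 1 else 0)"
  shows "norm (fourier_truncation e M x) \<le> norm x"
proof -
  let ?P = "fourier_truncation e M x"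
  have left: "cinner (e k) (x - ?P) = 0" if "k < M" for k
  proof -
    have "cinner (e k) ?P = (\<Sum>n<M. if n = k then cinner (e k) x else 0)"
      unfolding fourier_truncation_def cinner_sum_right
      by (intro sum.cong) (auto simp: cinner_scaleC_right on)
    then show ?thesis
      using that by (simp add: cinner_diff_right)
  qed
  have "cinner (x - ?P) (e k) = 0" if "k < M" for k
    using left[OF that] cinner_commute[of "x - ?P" "e k"] by simp
  then have "cinner (x - ?P) ?P = 0"
    \<comment> \<open>Only the second occurrence is expanded: the remainder stays intact, so that
      its orthogonality to each \<open>e k\<close> can be used term by term.\<close>
    by (subst (2) fourier_truncation_def) (simp add: cinner_sum_right cinner_scaleC_right)
  from norm_add_orthogonal[OF this] have "(norm x)\<^sup>2 = (norm (x - ?P))\<^sup>2 + (norm ?P)\<^sup>2"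
    by simp
  then have "(norm ?P)\<^sup>2 \<le> (norm x)\<^sup>2"
    by simp
  then show ?thesis
    by (rule power2_le_imp_le) simp
qed

text \<open>The vectors that are eventually fixed form a subspace, so it is enough to treat each
  \<open>e k\<close>.\<close>

lemma fourier_truncation_span_eventually:
  assumes on: "\<And>m n. cinner (e m) (e n) = (if m = n then 1 else 0)"
    and "x \<in> cspan (range e)"
  shows "\<exists>N. \<forall>M\<ge>N. fourier_truncation e M x = x"
  using assms(2)
proof (induction rule: complex_vector.span_induct)
  case base
  let ?S = "{x. \<exists>N. \<forall>M\<ge>N. fourier_truncation e M x = x}"
  show ?case
  proof (rule complex_vector.subspaceI)
    show "0 \<in> ?S"
      by (simp add: fourier_truncation_def)
  next
    fix x y
    assume "x \<in> ?S" "y \<in> ?S"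
    then obtain N N' where
      "\<forall>M\<ge>N. fourier_truncation e M x = x" "\<forall>M\<ge>N'. fourier_truncation e M y = y"
      by blast
    then have "\<forall>M\<ge>max N N'. fourier_truncation e M (x + y) = x + y"
      by (simp add: fourier_truncation_add)
    then show "x + y \<in> ?S" by blast
  next
    fix c x
    assume "x \<in> ?S"
    then show "c *\<^sub>C x \<in> ?S"
      by (auto simp: fourier_truncation_scaleC)
  qed
next
  case (step x)
  then obtain k where k: "x = e k" by auto
  \<comment> \<open>The sum runs over indices strictly below \<open>M\<close>, so the term for
    \<open>e k\<close> is present from \<open>Suc k\<close> on.\<close>
  have "fourier_truncation e M x = x" if "M \<ge> Suc k" for M
  proof -
    have "fourier_truncation e M x = (\<Sum>n<M. if n = k then e k else 0)"
      unfolding fourier_truncation_def k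
      by (intro sum.cong) (auto simp: on)
    then show ?thesis using that k by simp
  qed
  then show ?case by blast
qed

text \<open>Density of the span and the uniform contraction bound combine: near \<open>x\<close>
  lies some \<open>s\<close> in the span that late truncations fix, and the truncation of
  \<open>x - s\<close> is no longer than \<open>x - s\<close>.\<close>

lemma fourier_truncation_tendsto:
  assumes "orthonormal_basis e"
  shows "(\<lambda>M. fourier_truncation e M x) \<longlonglongrightarrow> x"
proof (rule LIMSEQ_I)
  fix r :: real
  assume "0 < r"
  have on: "\<And>m n. cinner (e m) (e n) = (if m = n then 1 else 0)"
    and "x \<in> closure (cspan (range e))"
    using assms by (auto simp: orthonormal_basis_def)
  then obtain s where s: "s \<in> cspan (range e)" "dist s x < r / 2"
    using \<open>0 < r\<close> by (metis closure_approachable half_gt_zero)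
  obtain N where N: "\<forall>M\<ge>N. fourier_truncation e M s = s"
    using fourier_truncation_span_eventually[OF on s(1)] by blast
  have "norm (fourier_truncation e M x - x) < r" if "M \<ge> N" for M
  proof -
    have "fourier_truncation e M x - x = fourier_truncation e M (x - s) + (s - x)"
      using N that by (simp add: fourier_truncation_diff)
    also have "norm \<dots> \<le> norm (x - s) + norm (s - x)"
      by (intro order_trans[OF norm_triangle_ineq] add_right_mono norm_fourier_truncation_le on)
    finally have "norm (fourier_truncation e M x - x) \<le> norm (x - s) + norm (s - x)" .
    then show ?thesis
      using s(2) by (simp add: dist_norm norm_minus_commute)
  qed
  then show "\<exists>N. \<forall>M\<ge>N. norm (fourier_truncation e M x - x) < r" by blast
qed

text \<open>Vectors with equal coefficients have identical truncations, and limits are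
  unique.\<close>

lemma orthonormal_basis_eqI:
  assumes "orthonormal_basis e" "\<And>n. cinner (e n) x = cinner (e n) y"
  shows "x = y"
proof (rule LIMSEQ_unique)
  show "(\<lambda>M. fourier_truncation e M x) \<longlonglongrightarrow> x"
    by (rule fourier_truncation_tendsto[OF assms(1)])
  show "(\<lambda>M. fourier_truncation e M x) \<longlonglongrightarrow> y"
    using fourier_truncation_tendsto[OF assms(1), of y]
    by (simp add: fourier_truncation_def assms(2))
qed

section \<open>Symmetry, continuity and linearity of operators\<close>

text \<open>The adjoint is given by a definite description, which yields its defining property only
  once the value is known to be unique. Uniqueness comes from testing against the basis vectors, all
  of which lie in the domain.\<close>

lemma self_adjoint_symmetric:
  assumes "self_adjoint V" "orthonormal_basis e" "range e \<subseteq> dom V"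
    and "f \<in> dom V" "g \<in> dom V"
  shows "cinner (V \<bullet>\<^sub>p f) g = cinner f (V \<bullet>\<^sub>p g)"
proof -
  let ?Q = "\<lambda>h. \<forall>f\<in>dom V. cinner (V \<bullet>\<^sub>p f) g = cinner f h"
  have eq: "V g = (if \<exists>h. ?Q h then Some (THE h. ?Q h) else None)"
    using assms(1) by (subst operator_adjoint_def[symmetric, THEN fun_cong]) (simp add: self_adjoint_def)
  with assms(5) have ex: "\<exists>h. ?Q h"
    by (auto split: if_splits)
  have "h = h'" if "?Q h" "?Q h'" for h h'
    using that assms(3) by (intro orthonormal_basis_eqI[OF assms(2)]) (metis rangeI subsetD)
  with ex have "\<exists>!h. ?Q h"
    by (rule ex_ex1I)
  then have "?Q (THE h. ?Q h)"
    by (rule theI')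
  moreover have "V \<bullet>\<^sub>p g = (THE h. ?Q h)"
    unfolding eq using ex by (simp only: if_True option.sel)
  ultimately show ?thesis
    using assms(4) by simp
qed

lemma bounded_operator_linear: "bounded_operator T \<Longrightarrow> Vector_Spaces.linear scaleC scaleC T"
  by (simp add: bounded_operator_def)

lemma bounded_operator_continuous_on:
  assumes "bounded_operator T"
  shows "continuous_on S T"
proof -
  interpret Vector_Spaces.linear scaleC scaleC T
    by (rule bounded_operator_linear[OF assms])
  obtain B where "\<And>x. norm (T x) \<le> B * norm x"
    using assms by (auto simp: bounded_operator_def)
  then have "bounded_linear T"
    by (intro bounded_linear_intro[where K = B])
      (auto simp: add scale scaleR_scaleC mult.commute)
  then show ?thesis
    by (rule linear_continuous_on)
qed

lemma linear_operator_sum: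
  assumes "linear_operator V" "finite A" "\<And>i. i \<in> A \<Longrightarrow> f i \<in> dom V"
  shows "(\<Sum>i\<in>A. c i *\<^sub>C f i) \<in> dom V \<and> V \<bullet>\<^sub>p (\<Sum>i\<in>A. c i *\<^sub>C f i) = (\<Sum>i\<in>A. c i *\<^sub>C (V \<bullet>\<^sub>p f i))"
proof -
  have sub: "csubspace (dom V)" and hom: "\<And>a f. f \<in> dom V \<Longrightarrow> V \<bullet>\<^sub>p (a *\<^sub>C f) = a *\<^sub>C (V \<bullet>\<^sub>p f)"
    and add: "\<And>f g. f \<in> dom V \<Longrightarrow> g \<in> dom V \<Longrightarrow> V \<bullet>\<^sub>p (f + g) = V \<bullet>\<^sub>p f + V \<bullet>\<^sub>p g"
    using assms(1) unfolding linear_operator_def by blast+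
  show ?thesis
    using assms(2,3)
  proof (induction A rule: finite_induct)
    case empty
    have "0 \<in> dom V" by (rule complex_vector.subspace_0[OF sub])
    \<comment> \<open>Homogeneity with scalar 0 gives that \<open>V\<close> sends 0 to 0.\<close>
    with hom[OF this, of 0] show ?case by auto
  next
    case (insert i A)
    have i: "f i \<in> dom V" and IH: "(\<Sum>i\<in>A. c i *\<^sub>C f i) \<in> dom V"
        "V \<bullet>\<^sub>p (\<Sum>i\<in>A. c i *\<^sub>C f i) = (\<Sum>i\<in>A. c i *\<^sub>C (V \<bullet>\<^sub>p f i))"
      using insert by blast+
    have ci: "c i *\<^sub>C f i \<in> dom V"
      by (rule complex_vector.subspace_scale[OF sub i])
    show ?case
      using complex_vector.subspace_add[OF sub ci IH(1)] add[OF ci IH(1)] hom[OF i] IH(2)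
        insert(1,2) by simp
  qed
qed

section \<open>Graphs, closures and cores\<close>

lemma mem_graph_iff: "(f, h) \<in> Map.graph V \<longleftrightarrow> f \<in> dom V \<and> h = V \<bullet>\<^sub>p f"
  by (auto simp: Map.graph_def)

lemma closure_graph_restrict_subset:
  assumes "closed_operator V"
  shows "closure (Map.graph (V |` C)) \<subseteq> Map.graph V"
proof (rule closure_minimal)
  show "Map.graph (V |` C) \<subseteq> Map.graph V"
    by (auto simp: Map.graph_def restrict_map_def split: if_splits)
  show "closed (Map.graph V)"
    using assms by (simp add: closed_operator_def)
qed

lemma graph_restrict_eq_image:
  assumes "C \<subseteq> dom V"
  shows "Map.graph (V |` C) = (\<lambda>f. (f, V \<bullet>\<^sub>p f)) ` C"
proof (intro equalityI subrelI)
  fix f h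
  assume "(f, h) \<in> Map.graph (V |` C)"
  then show "(f, h) \<in> (\<lambda>f. (f, V \<bullet>\<^sub>p f)) ` C"
    by (auto simp: Map.graph_def restrict_map_def split: if_splits)
next
  fix f h
  assume "(f, h) \<in> (\<lambda>f. (f, V \<bullet>\<^sub>p f)) ` C"
  with assms show "(f, h) \<in> Map.graph (V |` C)"
    by (auto simp: Map.graph_def)
qed

text \<open>Replaces an equation between partial functions by one between sets of pairs. The closure
  of the restricted graph stays inside the graph of the closed operator \<open>V\<close>, so the
  description in \<open>operator_closure\<close> has a unique value, that of
  \<open>V\<close>.\<close>

lemma is_core_iff_closure_graph:
  assumes "closed_operator V"
  shows "is_core C V \<longleftrightarrow>
    csubspace C \<and> C \<subseteq> dom V \<and> closure (Map.graph (V |` C)) = Map.graph V"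
proof -
  let ?G = "closure (Map.graph (V |` C))"
  have "?G \<subseteq> Map.graph V"
    by (rule closure_graph_restrict_subset[OF assms])
  then have uniq: "h = V \<bullet>\<^sub>p f" if "(f, h) \<in> ?G" for f h
    using that by (auto simp: mem_graph_iff)
  have "Map.graph (operator_closure (V |` C)) = ?G"
  proof (rule set_eqI, clarify)
    fix f h
    show "(f, h) \<in> Map.graph (operator_closure (V |` C)) \<longleftrightarrow> (f, h) \<in> ?G"
    proof (cases "\<exists>h. (f, h) \<in> ?G")
      case True
      then have f: "(f, V \<bullet>\<^sub>p f) \<in> ?G" using uniq by blast
      then have "(THE h. (f, h) \<in> ?G) = V \<bullet>\<^sub>p f" using uniq by blast
      then show ?thesis
        using f uniq[of f h] True by (auto simp: Map.graph_def operator_closure_def)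
    next
      case False
      then show ?thesis
        by (auto simp: Map.graph_def operator_closure_def)
    qed
  qed
  \<comment> \<open>A partial function is determined by its graph, so equality of operators, domains
    included, may be tested on graphs.\<close>
  moreover have "Map.graph U = Map.graph W \<longleftrightarrow> U = W" for U W :: "'a pop"
  proof
    assume "Map.graph U = Map.graph W"
    then have "U f = Some h \<longleftrightarrow> W f = Some h" for f h
      unfolding Map.graph_def by blast
    then show "U = W"
      by (metis not_Some_eq ext)
  qed simp
  ultimately show ?thesis
    unfolding is_core_def by metis
qed

lemma eigenbasis_span_core:
  assumes closed: "closed_operator V" and sa: "self_adjoint V"
    and basis: "orthonormal_basis e" and dom: "\<And>n. e n \<in> dom V"
    and eigen: "\<And>n. V \<bullet>\<^sub>p e n = complex_of_real (lam n) *\<^sub>C e n"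
  shows "is_core (cspan (range e)) V"
proof -
  let ?C = "cspan (range e)"
  have lin: "linear_operator V"
    using closed by (simp add: closed_operator_def)
  have sub: "?C \<subseteq> dom V"
    using lin dom by (intro complex_vector.span_minimal) (auto simp: linear_operator_def)
  have "Map.graph V \<subseteq> closure (Map.graph (V |` ?C))"
  proof clarify
    fix f h
    assume "(f, h) \<in> Map.graph V"
    then have f: "f \<in> dom V" and h: "h = V \<bullet>\<^sub>p f"
      by (auto simp: mem_graph_iff)
    have comm: "V \<bullet>\<^sub>p (fourier_truncation e M f) = fourier_truncation e M h" for M
    proof -
      \<comment> \<open>Symmetry moves \<open>V\<close> onto \<open>e n\<close>; the eigenvalue
        leaves the antilinear argument unconjugated because it is real.\<close>
      have "cinner (e n) h = complex_of_real (lam n) * cinner (e n) f" for n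
        using self_adjoint_symmetric[OF sa basis image_subsetI[OF dom] dom f, of n]
        by (simp add: h eigen cinner_scaleC_left)
      moreover have "V \<bullet>\<^sub>p (fourier_truncation e M f) = (\<Sum>n<M. cinner (e n) f *\<^sub>C (V \<bullet>\<^sub>p e n))"
        using linear_operator_sum[OF lin, of "{..<M}" e "\<lambda>n. cinner (e n) f"] dom
        by (simp add: fourier_truncation_def)
      ultimately show ?thesis
        by (simp add: fourier_truncation_def eigen mult.commute)
    qed
    have "fourier_truncation e M f \<in> ?C" for M
      unfolding fourier_truncation_def
      by (intro complex_vector.span_sum complex_vector.span_scale complex_vector.span_base) auto
    then have "(fourier_truncation e M f, fourier_truncation e M h) \<in> Map.graph (V |` ?C)" for M
      using sub comm[of M] by (auto simp: mem_graph_iff)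
    moreover have "(\<lambda>M. (fourier_truncation e M f, fourier_truncation e M h)) \<longlonglongrightarrow> (f, h)"
      by (intro tendsto_Pair fourier_truncation_tendsto basis)
    ultimately show "(f, h) \<in> closure (Map.graph (V |` ?C))"
      unfolding closure_sequential
      by (intro exI[of _ "\<lambda>M. (fourier_truncation e M f, fourier_truncation e M h)"]) simp
  qed
  moreover have "closure (Map.graph (V |` ?C)) \<subseteq> Map.graph V"
    by (rule closure_graph_restrict_subset[OF closed])
  ultimately show ?thesis
    using sub by (auto simp: is_core_iff_closure_graph[OF closed])
qed

section \<open>Similarity as transport of graphs\<close>

text \<open>Puts similarity in the same form as the core criterion: first components of the graph
  equation give the domains, second components give the intertwining relation.\<close>

lemma similar_via_iff_graph:
  assumes "bounded_with_bounded_inverse T"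
  shows "similar_via V K T \<longleftrightarrow> map_prod T T ` Map.graph K = Map.graph V"
proof
  assume "similar_via V K T"
  then have T: "T ` dom K = dom V" "\<And>f. f \<in> dom K \<Longrightarrow> V \<bullet>\<^sub>p T f = T (K \<bullet>\<^sub>p f)"
    by (auto simp: similar_via_def)
  show "map_prod T T ` Map.graph K = Map.graph V"
  proof (intro equalityI subrelI)
    fix g h
    assume "(g, h) \<in> map_prod T T ` Map.graph K"
    then show "(g, h) \<in> Map.graph V"
      using T by (auto simp: mem_graph_iff)
  next
    fix g h
    assume "(g, h) \<in> Map.graph V"
    then have g: "g \<in> dom V" "h = V \<bullet>\<^sub>p g"
      by (simp_all add: mem_graph_iff)
    then obtain f where "f \<in> dom K" "g = T f"
      using T(1) by blast
    with g T(2) have "(g, h) = map_prod T T (f, K \<bullet>\<^sub>p f)" "(f, K \<bullet>\<^sub>p f) \<in> Map.graph K"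
      by (simp_all add: mem_graph_iff)
    then show "(g, h) \<in> map_prod T T ` Map.graph K" by (rule image_eqI)
  qed
next
  assume eq: "map_prod T T ` Map.graph K = Map.graph V"
  have dom: "dom U = fst ` Map.graph U" for U :: "'a pop"
    by (force simp: Map.graph_def)
  have "T ` dom K = dom V"
    unfolding dom eq[symmetric] by force
  moreover have "V \<bullet>\<^sub>p T f = T (K \<bullet>\<^sub>p f)" if "f \<in> dom K" for f
  proof -
    have "(f, K \<bullet>\<^sub>p f) \<in> Map.graph K"
      using that by (simp add: mem_graph_iff)
    then have "map_prod T T (f, K \<bullet>\<^sub>p f) \<in> Map.graph V"
      unfolding eq[symmetric] by (rule imageI)
    then show ?thesis by (simp add: mem_graph_iff)
  qed
  ultimately show "similar_via V K T"
    using assms by (simp add: similar_via_def)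
qed

text \<open>Continuity of \<open>T\<close> gives one inclusion; the other is the same argument for
  \<open>inv T\<close>, carried back by \<open>T\<close>.\<close>

lemma closure_map_prod_image:
  assumes "bounded_with_bounded_inverse T"
  shows "closure (map_prod T T ` S) = map_prod T T ` closure S"
proof
  have inv: "inv T (T x) = x" "T (inv T x) = x" for x
    using assms by (simp_all add: bounded_with_bounded_inverse_def bij_is_inj bij_is_surj surj_f_inv_f)
  have cont_map_prod: "continuous_on X (map_prod U U)" if "bounded_operator U" for U :: "'a \<Rightarrow> 'a" and X
    unfolding map_prod_def case_prod_beta
    by (intro continuous_intros continuous_on_compose2[OF bounded_operator_continuous_on[OF that, of UNIV]])
      auto
  have cont: "continuous_on X (map_prod T T)" "continuous_on X (map_prod (inv T) (inv T))" for X
    using assms cont_map_prod by (simp_all add: bounded_with_bounded_inverse_def)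
  show "map_prod T T ` closure S \<subseteq> closure (map_prod T T ` S)"
    by (intro image_closure_subset cont closed_closure closure_subset)
  have "map_prod (inv T) (inv T) ` closure (map_prod T T ` S) \<subseteq> closure S"
    by (intro image_closure_subset cont closed_closure)
      (auto simp: inv intro: subsetD[OF closure_subset])
  from image_mono[OF this, of "map_prod T T"]
  show "closure (map_prod T T ` S) \<subseteq> map_prod T T ` closure S"
    by (simp add: image_image map_prod.compositionality comp_def inv split_beta)
qed

section \<open>Equivalence of similarity and the core property\<close>

theorem proposition2:
  fixes H0 H :: "'a::chilbert_space pop"
    and e \<phi> \<psi> :: "nat \<Rightarrow> 'a"
    and T :: "'a \<Rightarrow> 'a"
    and lam :: "nat \<Rightarrow> real"
  assumes "closed_operator H0" and "densely_defined H0" and "self_adjoint H0"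
    and "closed_operator H" and "densely_defined H"
    and "orthonormal_basis e"
    and "bounded_with_bounded_inverse T"
    and "\<And>n. \<phi> n = T (e n)"
    and "\<And>n. \<psi> n = inv (bounded_adjoint T) (e n)"
    and "\<And>n. e n \<in> dom H0"
    and "\<And>n. \<phi> n \<in> dom H"
    and "\<And>n. \<psi> n \<in> dom (operator_adjoint H)"
    and "\<And>n. H0 \<bullet>\<^sub>p e n = complex_of_real (lam n) *\<^sub>C e n"
    and "\<And>n. H \<bullet>\<^sub>p \<phi> n = complex_of_real (lam n) *\<^sub>C \<phi> n"
    and "\<And>n. operator_adjoint H \<bullet>\<^sub>p \<psi> n = complex_of_real (lam n) *\<^sub>C \<psi> n"
    and "\<And>n. T (H0 \<bullet>\<^sub>p e n) = H \<bullet>\<^sub>p T (e n)"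
    and "\<And>n. operator_adjoint H \<bullet>\<^sub>p inv (bounded_adjoint T) (e n)
           = inv (bounded_adjoint T) (H0 \<bullet>\<^sub>p e n)"
  shows "similar_via H H0 T \<longleftrightarrow> is_core (cspan (range (\<lambda>n. T (e n)))) H"
proof -
  note closed0 = assms(1) and sa = assms(3) and closed = assms(4) and basis = assms(6)
    and T = assms(7) and dom0 = assms(10) and eigen0 = assms(13)
  let ?D = "cspan (range e)" and ?C = "cspan (range (\<lambda>n. T (e n)))"
  interpret T: Vector_Spaces.linear scaleC scaleC T
    using T by (simp add: bounded_with_bounded_inverse_def bounded_operator_linear)
  have span: "?C = T ` ?D"
    using T.span_image[of "range e"] by (simp only: image_image cspan_def)
  have lin: "linear_operator H" and lin0: "linear_operator H0"
    using closed closed0 by (simp_all add: closed_operator_def)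
  have dom: "T (e n) \<in> dom H" for n
    using assms(8,11) by metis
  have sub: "?C \<subseteq> dom H"
    using lin dom by (intro complex_vector.span_minimal) (auto simp: linear_operator_def)
  have core0: "is_core ?D H0"
    by (rule eigenbasis_span_core[OF closed0 sa basis dom0 eigen0])
  then have sub0: "?D \<subseteq> dom H0" and graph0: "closure (Map.graph (H0 |` ?D)) = Map.graph H0"
    by (simp_all add: is_core_iff_closure_graph[OF closed0])
  \<comment> \<open>The relation is assumed only on the \<open>e n\<close>; linearity of
    \<open>H\<close>, \<open>H0\<close> and \<open>T\<close> extends it to finite
    combinations.\<close>
  have intertwine: "H \<bullet>\<^sub>p T f = T (H0 \<bullet>\<^sub>p f)" if fD: "f \<in> ?D" for f
  proof -
    obtain A r where "finite A" "A \<subseteq> range e" and f: "f = (\<Sum>a\<in>A. r a *\<^sub>C a)"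
      using fD by (auto simp: complex_vector.span_explicit)
    have A: "a \<in> dom H0" "T a \<in> dom H" "H \<bullet>\<^sub>p T a = T (H0 \<bullet>\<^sub>p a)" if aA: "a \<in> A" for a
    proof -
      obtain n where "a = e n"
        using \<open>A \<subseteq> range e\<close> aA by blast
      then show "a \<in> dom H0" "T a \<in> dom H" "H \<bullet>\<^sub>p T a = T (H0 \<bullet>\<^sub>p a)"
        using dom0[of n] dom[of n] assms(16)[of n] by simp_all
    qed
    have "H \<bullet>\<^sub>p T f = (\<Sum>a\<in>A. r a *\<^sub>C (H \<bullet>\<^sub>p T a))"
      using linear_operator_sum[where c = r, OF lin \<open>finite A\<close> A(2)] by (simp add: f T.sum T.scale)
    also have "\<dots> = T (\<Sum>a\<in>A. r a *\<^sub>C (H0 \<bullet>\<^sub>p a))"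
      by (simp add: A(3) T.sum T.scale)
    also have "\<dots> = T (H0 \<bullet>\<^sub>p f)"
      using linear_operator_sum[where c = r, OF lin0 \<open>finite A\<close> A(1)] by (simp add: f)
    finally show ?thesis .
  qed
  have "Map.graph (H |` ?C) = map_prod T T ` Map.graph (H0 |` ?D)"
    unfolding graph_restrict_eq_image[OF sub] graph_restrict_eq_image[OF sub0]
    by (simp add: span image_image intertwine)
  then have "closure (Map.graph (H |` ?C)) = map_prod T T ` Map.graph H0"
    by (simp add: closure_map_prod_image[OF T] graph0)
  \<comment> \<open>A span is a subspace and \<open>sub\<close> places it in the domain, so the core
    criterion reduces to its graph equation, which is now the one expressing similarity.\<close>
  then show ?thesis
    using sub by (auto simp: is_core_iff_closure_graph[OF closed] similar_via_iff_graph[OF T])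
qed

end
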